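(* Let $d^{\text{in}}, d^{\text{out}}, n, k$ be positive integers with $n\ge \max(d^{\text{in}},d^{\text{out}})$ and $1\le k\le \min(d^{\text{in}},d^{\text{out}})$, let $a,b>0$, and let $\bm{W}\in\mathbb{R}^{d^{\text{out}}\times d^{\text{in}}}$, $\bm{X}\in\mathbb{R}^{d^{\text{in}}\times n}$, $\bm{U}\in\mathbb{R}^{d^{\text{out}}\times k}$, $\bm{V}\in\mathbb{R}^{d^{\text{in}}\times k}$. Let $\bm{Y}:=Q_a(\bm{X})\in\mathcal{C}(a)\cap\mathbb{R}^{d^{\text{in}}\times n}$ and assume that $\bm{Y}$ is full rank. Define $$\widetilde{\bm{W}}:=(\bm{W}-\bm{U}\bm{V}^\top)\bm{X}\bm{Y}^\top(\bm{Y}\bm{Y}^\top)^{-1}.$$ Then the optimization problem $$\min_{\widehat{\bm{W}}\in\mathcal{C}(b)\cap\mathbb{R}^{d^{\text{out}}\times d^{\text{in}}}}\Vert \bm{W}\bm{X}-\widehat{\bm{W}}Q_a(\bm{X})-\bm{U}\bm{V}^\top\bm{X}\Vert_2^2$$ is equivalent to the optimization problem $$\min_{\widehat{\bm{W}}\in\mathcal{C}(b)\cap\mathbb{R}^{d^{\text{out}}\times d^{\text{in}}}}\Vert \widetilde{\bm{W}}\bm{Y}-\widehat{\bm{W}}\bm{Y}\Vert_2^2,$$ i.e. the two problems have the same set of minimizers.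
   Context: $\Vert\cdot\Vert_2$ applied to a matrix denotes the Frobenius norm (square root of the sum of squared entries). For $b>0$, $\mathcal{C}(b)$ denotes the set of real matrices that can be represented with a bit precision of $b$ bits per entry; it enters the statement only as a fixed (possibly non-convex) constraint set of matrices and may be treated as an arbitrary set. For $a>0$, $Q_a$ is any quantization operator: a map sending each real matrix $\bm{Z}$ to a real matrix $Q_a(\bm{Z})$ of the same shape with $Q_a(\bm{Z})\in\mathcal{C}(a)$. Two optimization problems are called equivalent if they have the same solutions. A matrix of size $d^{\text{in}}\times n$ with $n\ge d^{\text{in}}$ is full rank if its rank is $d^{\text{in}}$. *)

theory Defs
  imports
    Complex_Main
    "Jordan_Normal_Form.DL_Rank"
    "Jordan_Normal_Form.Gauss_Jordan_Elimination"
begin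

definition frobenius_norm :: "real mat \<Rightarrow> real" where
  "frobenius_norm A = sqrt (\<Sum>i<dim_row A. \<Sum>j<dim_col A. (A $$ (i, j))\<^sup>2)"

text \<open>
  The set \<open>S\<close> plays the role of the matrices representable with a given bit precision and
  may contain matrices of all shapes. Only nonempty shapes are constrained, so that \<open>S\<close> is
  not required to contain any matrix without entries.
\<close>

definition quantization_operator :: "real mat set \<Rightarrow> (real mat \<Rightarrow> real mat) \<Rightarrow> bool" where
  "quantization_operator S Q \<longleftrightarrow>
     (\<forall>r c. \<forall>Z \<in> carrier_mat r c. 0 < r \<longrightarrow> 0 < c \<longrightarrow> Q Z \<in> S \<inter> carrier_mat r c)"

definition minimizers :: "('a \<Rightarrow> real) \<Rightarrow> 'a set \<Rightarrow> 'a set" where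
  "minimizers f S = {x. is_arg_min f (\<lambda>y. y \<in> S) x}"

text \<open>
  \<^const>\<open>mat_inverse\<close> returns an option; the value of \<open>mat_inv\<close> is only
  meaningful for invertible square matrices.
\<close>

definition mat_inv :: "real mat \<Rightarrow> real mat" where
  "mat_inv A = the (mat_inverse A)"

end

theory Submission
  imports Defs
begin

text \<open>
  \<open>Wt\<close> is the least-squares solution of \<open>Wt * Y \<approx> (W - U * V\<^sup>T) * X\<close>, so the residual
  \<open>A = (W - U * V\<^sup>T) * X - Wt * Y\<close> satisfies \<open>A * Y\<^sup>T = 0\<close> and is orthogonal to every \<open>D * Y\<close>. By Pythagoras the two objectives differ by
  the constant \<open>\<parallel>A\<parallel>\<^sup>2\<close>.
\<close>

lemma minimizers_add_const:
  assumes "\<And>x. x \<in> S \<Longrightarrow> f x = c + g x"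
  shows "minimizers f S = minimizers g S"
  using assms by (auto simp: minimizers_def is_arg_min_def)

lemma frobenius_norm_squared:
  "(frobenius_norm A)\<^sup>2 = (\<Sum>i<dim_row A. \<Sum>j<dim_col A. (A $$ (i, j))\<^sup>2)"
  unfolding frobenius_norm_def by (intro real_sqrt_pow2 sum_nonneg) auto

text \<open>The diagonal entries of \<open>A * B\<^sup>T\<close> are the inner products of
  corresponding rows of \<open>A\<close> and \<open>B\<close>, so the cross terms in the expanded
  squares cancel row by row.\<close>

lemma frobenius_norm_add_orthogonal:
  assumes A: "A \<in> carrier_mat r c" and B: "B \<in> carrier_mat r c"
    and orth: "A * B\<^sup>T = 0\<^sub>m r r"
  shows "(frobenius_norm (A + B))\<^sup>2 = (frobenius_norm A)\<^sup>2 + (frobenius_norm B)\<^sup>2"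
proof -
  have cross: "(\<Sum>j<c. A $$ (i, j) * B $$ (i, j)) = 0" if "i < r" for i
  proof -
    have "(\<Sum>j<c. A $$ (i, j) * B $$ (i, j)) = (A * B\<^sup>T) $$ (i, i)"
      using A B that by (auto simp: scalar_prod_def atLeast0LessThan intro!: sum.cong)
    then show ?thesis
      using orth that by simp
  qed
  have "(\<Sum>j<c. ((A + B) $$ (i, j))\<^sup>2) = (\<Sum>j<c. (A $$ (i, j))\<^sup>2) + (\<Sum>j<c. (B $$ (i, j))\<^sup>2)"
    if "i < r" for i
  proof -
    have "(\<Sum>j<c. ((A + B) $$ (i, j))\<^sup>2) =
        (\<Sum>j<c. (A $$ (i, j))\<^sup>2 + (B $$ (i, j))\<^sup>2 + 2 * (A $$ (i, j) * B $$ (i, j)))"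
      using A B that by (intro sum.cong) (auto simp: power2_sum)
    then show ?thesis
      using cross[OF that] by (simp add: sum.distrib flip: sum_distrib_left)
  qed
  then show ?thesis
    using A B by (simp add: frobenius_norm_squared sum.distrib)
qed

text \<open>A maximal linearly independent set of columns has \<open>rank A = n\<close> elements and
  is therefore a basis of the whole \<open>n\<close>-dimensional space.\<close>

lemma (in vec_space) full_rank_col_space:
  assumes A: "A \<in> carrier_mat n nc" and rank: "rank A = n"
  shows "col_space A = carrier_vec n"
proof -
  let ?P = "\<lambda>T. T \<subseteq> set (cols A) \<and> lin_indpt T"
  have cols: "set (cols A) \<subseteq> carrier_vec n"
    using cols_dim A by blast
  \<comment> \<open>The empty set is the independent set from which a maximal one is grown.\<close>
  have "?P {}"
    by (simp add: lin_dep_def)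
  then obtain B where B: "maximal B ?P" "finite B"
    using maximal_exists_superset[of "set (cols A)" ?P "{}"] by auto
  then have sub: "B \<subseteq> set (cols A)" and li: "lin_indpt B"
    by (auto simp: maximal_def)
  have "card B = n"
    using rank_card_indpt[OF A B(1)] rank by simp
  then have "basis B"
    using dim_li_is_basis[OF fin_dim B(2)] sub cols li dim_is_n by auto
  then have "carrier_vec n \<subseteq> span B"
    by (simp add: basis_def)
  then show ?thesis
    unfolding col_space_def using span_is_monotone[OF sub] span_closed[OF cols] by auto
qed

text \<open>If \<open>v\<close> lies in the kernel of the Gram matrix, then
  \<open>Y\<^sup>T *\<^sub>v v\<close> has squared length
  \<open>v \<bullet> (Y * Y\<^sup>T *\<^sub>v v) = 0\<close> and vanishes. Full rank makes
  \<open>Y\<close> surjective, so \<open>v = Y *\<^sub>v w\<close> for some \<open>w\<close>, and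
  \<open>v \<bullet> v = w \<bullet> (Y\<^sup>T *\<^sub>v v) = 0\<close> forces
  \<open>v = 0\<close>.\<close>

lemma full_rank_gram_det:
  fixes Y :: "real mat"
  assumes Y: "Y \<in> carrier_mat d n" and rank: "vec_space.rank d Y = d"
  shows "det (Y * Y\<^sup>T) \<noteq> 0"
proof
  interpret vec_space "TYPE(real)" d .
  assume "det (Y * Y\<^sup>T) = 0"
  then obtain v where v: "v \<in> carrier_vec d" "v \<noteq> 0\<^sub>v d" "(Y * Y\<^sup>T) *\<^sub>v v = 0\<^sub>v d"
    using det_0_iff_vec_prod_zero[of "Y * Y\<^sup>T" d] Y by auto
  let ?u = "Y\<^sup>T *\<^sub>v v"
  have u: "?u \<in> carrier_vec n"
    using Y v by simp
  have eq: "Y *\<^sub>v ?u = 0\<^sub>v d"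
    using v Y by (simp add: assoc_mult_mat_vec[of Y d n "Y\<^sup>T" d])
  have move: "(Y *\<^sub>v w) \<bullet> v = w \<bullet> ?u" if "w \<in> carrier_vec n" for w
    using transpose_vec_mult_scalar[OF Y that v(1)] comm_scalar_prod that u
      comm_scalar_prod[OF mult_mat_vec_carrier[OF Y that] v(1)] by metis
  have "?u \<bullet> ?u = 0"
    using move[OF u] eq v(1) by simp
  \<comment> \<open>Conjugation is the identity on the reals, so definiteness of the conjugate
    scalar product applies to the plain one.\<close>
  then have u0: "?u = 0\<^sub>v n"
    using u by (simp add: conjugate_square_eq_0_vec[of ?u n, simplified])
  obtain w where w: "w \<in> carrier_vec n" "Y *\<^sub>v w = v"
    using full_rank_col_space[OF Y rank] v(1) Y by (auto simp: col_space_eq[OF Y])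
  have "v \<bullet> v = 0"
    using move[OF w(1)] w u0 by simp
  then show False
    using v by (simp add: conjugate_square_eq_0_vec[of v d, simplified])
qed

text \<open>A nonzero determinant makes \<open>A\<close> a unit of the matrix ring, which excludes
  the result \<open>None\<close>; hence \<open>the\<close> in \<open>mat_inv\<close> returns a
  genuine inverse.\<close>

lemma mat_inv_left:
  assumes A: "A \<in> carrier_mat n n" and "det A \<noteq> 0"
  shows "mat_inv A \<in> carrier_mat n n" "mat_inv A * A = 1\<^sub>m n"
proof -
  have "A \<in> Units (ring_mat TYPE(real) n ())"
    using det_non_zero_imp_unit[OF assms] .
  then obtain B where "mat_inverse A = Some B"
    using mat_inverse(1)[OF A, where b = "()"] by (cases "mat_inverse A") auto
  then show "mat_inv A \<in> carrier_mat n n" "mat_inv A * A = 1\<^sub>m n"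
    using mat_inverse(2)[OF A] by (auto simp: mat_inv_def)
qed

lemma least_squares_pythagoras:
  assumes M: "M \<in> carrier_mat m n" and Y: "Y \<in> carrier_mat d n"
    and rank: "vec_space.rank d Y = d"
    and Z: "Z \<in> carrier_mat m d"
  defines "P \<equiv> M * Y\<^sup>T * mat_inv (Y * Y\<^sup>T)"
  shows "(frobenius_norm (M - Z * Y))\<^sup>2 =
    (frobenius_norm (M - P * Y))\<^sup>2 + (frobenius_norm (P * Y - Z * Y))\<^sup>2"
proof -
  let ?G = "Y * Y\<^sup>T"
  have YT: "Y\<^sup>T \<in> carrier_mat n d" and G: "?G \<in> carrier_mat d d"
    using Y by auto
  note inv = mat_inv_left[OF G full_rank_gram_det[OF Y rank]]
  have MY: "M * Y\<^sup>T \<in> carrier_mat m d"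
    using M YT by simp
  have P: "P \<in> carrier_mat m d"
    unfolding P_def using MY inv(1) by (rule mult_carrier_mat)
  have PY: "P * Y \<in> carrier_mat m n" and ZY: "Z * Y \<in> carrier_mat m n"
    using P Z Y by auto
  \<comment> \<open>This chain is the normal equation \<open>P * ?G = M * Y\<^sup>T\<close>: the
    inverse in \<open>P\<close> cancels the Gram matrix.\<close>
  have "P * Y * Y\<^sup>T = P * ?G"
    using assoc_mult_mat[OF P Y YT] .
  also have "\<dots> = M * Y\<^sup>T * (mat_inv ?G * ?G)"
    unfolding P_def using assoc_mult_mat[OF MY inv(1) G] .
  also have "\<dots> = M * Y\<^sup>T"
    unfolding inv(2) using right_mult_one_mat[OF MY] .
  finally have residual: "(M - P * Y) * Y\<^sup>T = 0\<^sub>m m d"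
    using minus_mult_distrib_mat[OF M PY YT] MY by simp
  have A: "M - P * Y \<in> carrier_mat m n" and D: "P - Z \<in> carrier_mat m d"
    using minus_carrier_mat[OF PY] minus_carrier_mat[OF Z] by blast+
  have B: "P * Y - Z * Y = (P - Z) * Y"
    using minus_mult_distrib_mat[OF P Z Y] by simp
  \<comment> \<open>Transposing \<open>(P - Z) * Y\<close> puts \<open>Y\<^sup>T\<close> next to the
    residual, which annihilates it whatever \<open>Z\<close> is.\<close>
  have "(M - P * Y) * (P * Y - Z * Y)\<^sup>T = (M - P * Y) * Y\<^sup>T * (P - Z)\<^sup>T"
    unfolding B transpose_mult[OF D Y] using A YT D
    by (simp add: assoc_mult_mat[of _ m n _ d _ m])
  also have "\<dots> = 0\<^sub>m m m"
    unfolding residual using D by (intro left_mult_zero_mat) (simp only: transpose_carrier_mat)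
  finally have "(frobenius_norm ((M - P * Y) + (P * Y - Z * Y)))\<^sup>2 =
    (frobenius_norm (M - P * Y))\<^sup>2 + (frobenius_norm (P * Y - Z * Y))\<^sup>2"
    by (rule frobenius_norm_add_orthogonal[OF A minus_carrier_mat[OF ZY]])
  moreover have "(M - P * Y) + (P * Y - Z * Y) = M - Z * Y"
    using M P Z Y by (intro eq_matI) auto
  ultimately show ?thesis
    by simp
qed

theorem proposition3p1:
  fixes d_in d_out n k :: nat
    and a b :: real
    and C :: "real \<Rightarrow> real mat set"
    and Q :: "real mat \<Rightarrow> real mat"
    and W X U V Y Wt :: "real mat"
  assumes "0 < d_in" and "0 < d_out" and "0 < n" and "0 < k"
    and "max d_in d_out \<le> n"
    and "1 \<le> k" and "k \<le> min d_in d_out"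
    and "0 < a" and "0 < b"
    and "W \<in> carrier_mat d_out d_in"
    and "X \<in> carrier_mat d_in n"
    and "U \<in> carrier_mat d_out k"
    and "V \<in> carrier_mat d_in k"
    and "quantization_operator (C a) Q"
    and "Y = Q X"
    and "vec_space.rank d_in Y = d_in"
    and "Wt = (W - U * V\<^sup>T) * X * Y\<^sup>T * mat_inv (Y * Y\<^sup>T)"
  shows
    "minimizers (\<lambda>Wh. (frobenius_norm (W * X - Wh * Q X - U * V\<^sup>T * X))\<^sup>2)
       (C b \<inter> carrier_mat d_out d_in) =
     minimizers (\<lambda>Wh. (frobenius_norm (Wt * Y - Wh * Y))\<^sup>2)
       (C b \<inter> carrier_mat d_out d_in)"
proof (rule minimizers_add_const)
  note W = \<open>W \<in> carrier_mat d_out d_in\<close> and X = \<open>X \<in> carrier_mat d_in n\<close>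
    and Y_eq = \<open>Y = Q X\<close> and Wt_eq = \<open>Wt = _\<close>
  let ?M = "(W - U * V\<^sup>T) * X"
  fix Z
  assume "Z \<in> C b \<inter> carrier_mat d_out d_in"
  then have Z: "Z \<in> carrier_mat d_out d_in"
    by simp
  \<comment> \<open>Both \<open>d_in\<close> and \<open>n\<close> are positive, so the shape
    guarantee of the quantization operator covers \<open>X\<close>.\<close>
  have Y: "Y \<in> carrier_mat d_in n"
    using assms by (auto simp: quantization_operator_def)
  have UV: "U * V\<^sup>T \<in> carrier_mat d_out d_in"
    using assms by simp
  have M: "?M \<in> carrier_mat d_out n"
    using minus_carrier_mat[OF UV] X by (rule mult_carrier_mat)
  \<comment> \<open>Regrouping turns the first objective into a least-squares problem in
    \<open>Z\<close> with target \<open>?M\<close>.\<close>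
  have "W * X - Z * Y - U * V\<^sup>T * X = ?M - Z * Y"
    unfolding minus_mult_distrib_mat[OF W UV X]
    using W X UV Z Y by (intro eq_matI) auto
  \<comment> \<open>The constant \<open>c\<close> is instantiated here with the squared residual of
    \<open>Wt\<close>, which does not depend on \<open>Z\<close>.\<close>
  then show "(frobenius_norm (W * X - Z * Q X - U * V\<^sup>T * X))\<^sup>2 =
      (frobenius_norm (?M - Wt * Y))\<^sup>2 + (frobenius_norm (Wt * Y - Z * Y))\<^sup>2"
    using least_squares_pythagoras[OF M Y \<open>vec_space.rank d_in Y = d_in\<close> Z]
    unfolding Wt_eq by (simp flip: Y_eq)
qed

end
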